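(* Let $\mathcal{A}\in\mathbb{R}^{n\times n}$ be an $H_+$-matrix, let $\sigma\in\mathbb{R}^n$, and let $\mathcal{A}=\mathcal{M}-\mathcal{N}=(\mathcal{M}+I+D_{\mathcal{A}})-(\mathcal{N}+I+D_{\mathcal{A}})$ be an $H$-compatible splitting of $\mathcal{A}$, with $\mathcal{M},\mathcal{N}\in\mathbb{R}^{n\times n}$, in the sense that $$\langle\mathcal{A}\rangle=\langle\mathcal{M}\rangle-|\mathcal{N}|=\langle\mathcal{M}+I+D_{\mathcal{A}}\rangle-|\mathcal{N}+I+D_{\mathcal{A}}| .$$ Suppose that one of the following conditions holds: (1) $D_{\mathcal{A}}\ge I$ and $\langle\mathcal{A}\rangle+2I-D_{\mathcal{A}}-|B|$ is an $M$-matrix, where $B=L_{\mathcal{A}}+U_{\mathcal{A}}$; (2) $D_{\mathcal{A}}<I$, i.e. every diagonal entry of $\mathcal{A}$ is less than $1$. Let $\zeta_+^{*}\in\mathbb{R}^n$ be the solution of the fixed point equation $$\zeta_{+}=(\mathcal{M}+2I+D_{\mathcal{A}})^{-1}\big[(\mathcal{N}+I+D_{\mathcal{A}})\zeta_{+}+|(\mathcal{A}-I)\zeta_{+}+\sigma|-\sigma\big].$$ Then for any initial vector $\zeta^{(0)}\in\mathbb{R}^n$, the sequence $\{\zeta_+^{(\eta)}\}_{\eta=1}^{+\infty}$ generated from $\zeta_+^{(0)}=\max\{0,\zeta^{(0)}\}$ by $$\zeta^{(\eta+1)}_{+}=(\mathcal{M}+2I+D_{\mathcal{A}})^{-1}\big[(\mathcal{N}+I+D_{\mathcal{A}})\zeta^{(\eta)}_{+}+|(\mathcal{A}-I)\zeta^{(\eta)}_{+}+\sigma|-\sigma\big],\qquad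 \eta=0,1,2,\ldots,$$ converges to $\zeta_+^{*}$.
   Context: $I$ is the $n\times n$ identity matrix. Write $\mathcal{A}=D_{\mathcal{A}}-L_{\mathcal{A}}-U_{\mathcal{A}}$, where $D_{\mathcal{A}}$ is the diagonal part of $\mathcal{A}$, and $-L_{\mathcal{A}}$, $-U_{\mathcal{A}}$ are its strictly lower and strictly upper triangular parts. For a vector or matrix, $|\cdot|$ denotes the entrywise absolute value; inequalities between matrices are entrywise (for the diagonal matrices in $D_{\mathcal{A}}<I$, the strict inequality is between diagonal entries); $\max\{0,\zeta\}$ of a vector is entrywise. The comparison matrix $\langle\mathcal{A}\rangle$ of $\mathcal{A}=(a_{ij})$ has entries $|a_{ii}|$ on the diagonal and $-|a_{ij}|$ for $i\ne j$. A $Z$-matrix is a real square matrix whose off-diagonal entries are all $\le 0$; an $M$-matrix is a nonsingular $Z$-matrix with entrywise nonnegative inverse; an $H$-matrix is a matrix whose comparison matrix is an $M$-matrix; an $H_+$-matrix is an $H$-matrix with all diagonal entries positive. A splitting $\mathcal{A}=\mathcal{M}-\mathcal{N}$ is $H$-compatible if $\langle\mathcal{A}\rangle=\langle\mathcal{M}\rangle-|\mathcal{N}|$. The iteration is used for splittings with $\mathcal{M}+2I+D_{\mathcal{A}}$ nonsingular. In the iteration, $\zeta_+^{(\eta+1)}$ is simply the name of the vector given by the right-hand side (no further positive part is taken for $\eta\ge 0$). *)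

theory Defs
  imports "HOL-Analysis.Analysis"
begin

text \<open>
  The library orders \<open>real ^ 'n\<close> and, by nesting, \<open>real ^ 'n ^ 'n\<close> entrywise, and its absolute
  value \<open>\<bar>_\<bar>\<close> is entrywise on both types. The strict order \<open><\<close> on these types is not entrywise
  (it means \<open>\<le>\<close> and \<open>\<noteq>\<close>), so strict entrywise inequalities are written out below.
\<close>

lemma abs_matrix_entry: "\<bar>A :: real ^ 'n ^ 'm\<bar> $ i $ j = \<bar>A $ i $ j\<bar>"
  by (simp add: abs_vec_def)

lemma le_matrix_entrywise:
  "(A :: real ^ 'n ^ 'm) \<le> B \<longleftrightarrow> (\<forall>i j. A $ i $ j \<le> B $ i $ j)"
  by (simp add: less_eq_vec_def)

definition diag_part :: "real ^ 'n ^ 'n \<Rightarrow> real ^ 'n ^ 'n" where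
  "diag_part A = (\<chi> i j. if i = j then A $ i $ j else 0)"

text \<open>
  The sign convention is \<open>A = D - L - U\<close>: the parts \<open>L\<close> and \<open>U\<close> carry the negated entries of \<open>A\<close>.
\<close>

definition lower_part ::
    "real ^ ('n :: {finite,linorder}) ^ ('n :: {finite,linorder}) \<Rightarrow>
      real ^ ('n :: {finite,linorder}) ^ ('n :: {finite,linorder})" where
  "lower_part A = (\<chi> i j. if j < i then - (A $ i $ j) else 0)"

definition upper_part ::
    "real ^ ('n :: {finite,linorder}) ^ ('n :: {finite,linorder}) \<Rightarrow>
      real ^ ('n :: {finite,linorder}) ^ ('n :: {finite,linorder})" where
  "upper_part A = (\<chi> i j. if i < j then - (A $ i $ j) else 0)"

lemma diag_lower_upper_decomposition:
  "A = diag_part A - lower_part A - upper_part A"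
  by (auto simp: vec_eq_iff diag_part_def lower_part_def upper_part_def)

definition comparison_matrix :: "real ^ 'n ^ 'n \<Rightarrow> real ^ 'n ^ 'n" where
  "comparison_matrix A = (\<chi> i j. if i = j then \<bar>A $ i $ j\<bar> else - \<bar>A $ i $ j\<bar>)"

definition Z_matrix :: "real ^ 'n ^ 'n \<Rightarrow> bool" where
  "Z_matrix A \<longleftrightarrow> (\<forall>i j. i \<noteq> j \<longrightarrow> A $ i $ j \<le> 0)"

definition M_matrix :: "real ^ 'n ^ 'n \<Rightarrow> bool" where
  "M_matrix A \<longleftrightarrow> Z_matrix A \<and> invertible A \<and> 0 \<le> matrix_inv A"

definition H_matrix :: "real ^ 'n ^ 'n \<Rightarrow> bool" where
  "H_matrix A \<longleftrightarrow> M_matrix (comparison_matrix A)"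

definition H_plus_matrix :: "real ^ 'n ^ 'n \<Rightarrow> bool" where
  "H_plus_matrix A \<longleftrightarrow> H_matrix A \<and> (\<forall>i. 0 < A $ i $ i)"

definition H_compatible_splitting ::
    "real ^ 'n ^ 'n \<Rightarrow> real ^ 'n ^ 'n \<Rightarrow> real ^ 'n ^ 'n \<Rightarrow> bool" where
  "H_compatible_splitting A M N \<longleftrightarrow>
     A = M - N \<and> comparison_matrix A = comparison_matrix M - \<bar>N\<bar>"

text \<open>
  Right-hand side of the modulus-based fixed point equation and of the iteration. It is meant for
  \<open>M + 2I + D\<close> nonsingular, since the library's \<open>matrix_inv\<close> is unspecified otherwise.
\<close>

definition iteration_map ::
    "real ^ 'n ^ 'n \<Rightarrow> real ^ 'n ^ 'n \<Rightarrow> real ^ 'n ^ 'n \<Rightarrow> real ^ 'n \<Rightarrow> real ^ 'n \<Rightarrow> real ^ 'n" where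
  "iteration_map A M N \<sigma> z =
     matrix_inv (M + 2 *\<^sub>R mat 1 + diag_part A) *v
       ((N + mat 1 + diag_part A) *v z + \<bar>(A - mat 1) *v z + \<sigma>\<bar> - \<sigma>)"

end

theory Submission
  imports Defs
begin

text \<open>
  Put \<open>P = M + 2I + D\<close> and let \<open>e\<^sub>k\<close> be the error of the \<open>k\<close>-th iterate. Subtracting the fixed
  point equation from the recursion and using that the modulus is nonexpansive gives
  \<open>\<bar>P e\<^sub>k\<^sub>+\<^sub>1\<bar> \<le> T \<bar>e\<^sub>k\<bar>\<close> with \<open>T = \<bar>N + I + D\<bar> + \<bar>A - I\<bar>\<close>. On the left, \<open>\<langle>P\<rangle> \<bar>x\<bar> \<le> \<bar>P x\<bar>\<close> holds for
  every vector, so the errors satisfy the linear recursive inequality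
  \<open>\<langle>P\<rangle> \<bar>e\<^sub>k\<^sub>+\<^sub>1\<bar> \<le> T \<bar>e\<^sub>k\<bar>\<close>.

  Such a recursion contracts as soon as \<open>\<langle>P\<rangle> - T\<close> is an \<open>M\<close>-matrix
  (\<open>Z_matrix_recursion_tendsto_zero\<close>): the \<open>M\<close>-matrix supplies a positive vector \<open>u\<close> with
  \<open>(\<langle>P\<rangle> - T) u = (1, \<dots>, 1)\<close>, hence \<open>T u \<le> \<rho> \<langle>P\<rangle> u\<close> for some \<open>\<rho> < 1\<close>, and because a \<open>Z\<close>-matrix
  that maps a positive vector to a positive vector reflects inequalities, \<open>\<bar>e\<^sub>k\<bar> \<le> c u\<close> implies
  \<open>\<bar>e\<^sub>k\<^sub>+\<^sub>1\<bar> \<le> \<rho> c u\<close>. This replaces the spectral radius by a weighted maximum norm.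

  It remains to identify \<open>\<langle>P\<rangle> - T\<close>. Compatibility of the shifted splitting forces
  \<open>M + I + D\<close> to have a nonnegative diagonal, so \<open>\<langle>P\<rangle> = \<langle>M + I + D\<rangle> + I\<close>, and the same
  compatibility then yields \<open>\<langle>P\<rangle> - T = \<langle>A\<rangle> + I - \<bar>A - I\<bar>\<close>. If all
  diagonal entries of \<open>A\<close> are at least \<open>1\<close>, this is the matrix of condition (1); if they are all below \<open>1\<close>, it is \<open>2 \<langle>A\<rangle>\<close>, an \<open>M\<close>-matrix because \<open>A\<close> is
  an \<open>H\<close>-matrix.
\<close>

section \<open>Positive vectors and monotonicity\<close>

lemma matrix_inv_mult:
  fixes W :: "real ^ 'n ^ 'n"
  assumes "invertible W"
  shows "W ** matrix_inv W = mat 1" "matrix_inv W ** W = mat 1"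
proof -
  have "W ** matrix_inv W = mat 1 \<and> matrix_inv W ** W = mat 1"
    using assms unfolding invertible_def matrix_inv_def by (rule someI_ex)
  then show "W ** matrix_inv W = mat 1" "matrix_inv W ** W = mat 1"
    by simp_all
qed

lemma matrix_inv_eqI:
  fixes W V :: "real ^ 'n ^ 'n"
  assumes "W ** V = mat 1" "V ** W = mat 1"
  shows "matrix_inv W = V"
proof -
  have "invertible W"
    using assms unfolding invertible_def by blast
  then have "matrix_inv W ** (W ** V) = V"
    by (simp add: matrix_mul_assoc matrix_inv_mult)
  then show ?thesis
    by (simp add: assms)
qed

lemma matrix_vector_mult_mono_nonneg:
  fixes T :: "real ^ 'n ^ 'm"
  assumes "0 \<le> T" "x \<le> y"
  shows "T *v x \<le> T *v y"
  using assms by (auto simp: less_eq_vec_def matrix_vector_mult_def intro!: sum_mono mult_left_mono)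

lemma abs_matrix_vector_mult_le:
  fixes T :: "real ^ 'n ^ 'm"
  shows "\<bar>T *v x\<bar> \<le> \<bar>T\<bar> *v \<bar>x\<bar>"
  by (auto simp: less_eq_vec_def matrix_vector_mult_def abs_vec_def abs_mult
      intro!: order_trans[OF sum_abs])

text \<open>
  The solution of \<open>W u = (1, \<dots>, 1)\<close> is nonnegative because the inverse is. It cannot vanish at
  \<open>i\<close>: all other terms of row \<open>i\<close> are at most \<open>0\<close>, so only the diagonal term can produce the \<open>1\<close>.
\<close>

lemma M_matrix_positive_vector:
  fixes W :: "real ^ 'n ^ 'n"
  assumes "M_matrix W"
  obtains u where "\<And>i. 0 < u $ i" "W *v u = 1"
proof
  let ?u = "matrix_inv W *v 1"
  have Z: "W $ i $ j \<le> 0" if "i \<noteq> j" for i j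
    using assms that by (auto simp: M_matrix_def Z_matrix_def)
  have inv: "invertible W" and nonneg: "0 \<le> matrix_inv W"
    using assms by (auto simp: M_matrix_def)
  show eq: "W *v ?u = 1"
    using matrix_inv_mult[OF inv] by (simp add: matrix_vector_mul_assoc)
  have "0 \<le> ?u"
    using matrix_vector_mult_mono_nonneg[OF nonneg, of 0 1]
    by (simp add: less_eq_vec_def)
  then have u0: "0 \<le> ?u $ i" for i
    by (simp add: less_eq_vec_def)
  show "0 < ?u $ i" for i
  proof (rule ccontr)
    assume "\<not> 0 < ?u $ i"
    then have ui: "?u $ i = 0"
      using u0[of i] by linarith
    have "W $ i $ j * ?u $ j \<le> 0" for j
      using Z[of i j] u0[of j] ui by (cases "j = i") (auto intro: mult_nonpos_nonneg)
    then have "(W *v ?u) $ i \<le> 0"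
      unfolding matrix_vector_mult_def[of W] by (auto intro!: sum_nonpos)
    then show False
      unfolding eq by simp
  qed
qed

text \<open>
  A discrete maximum principle. At an index \<open>i\<close> where \<open>y - z\<close> is largest relative to \<open>u\<close>, say
  \<open>y\<^sub>i - z\<^sub>i = t u\<^sub>i\<close>, the sign pattern of row \<open>i\<close> gives \<open>(C (y - z))\<^sub>i \<ge> t (C u)\<^sub>i\<close>; the left
  side is at most \<open>0\<close> and \<open>(C u)\<^sub>i\<close> is positive, so \<open>t \<le> 0\<close>.
\<close>

lemma Z_matrix_reflects_le:
  fixes C :: "real ^ 'n ^ 'n"
  assumes Z: "Z_matrix C"
    and u: "\<And>i. 0 < u $ i" and Cu: "\<And>i. 0 < (C *v u) $ i"
    and le: "C *v y \<le> C *v z"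
  shows "y \<le> z"
proof -
  define d where "d = y - z"
  define t where "t = Max (range (\<lambda>i. d $ i / u $ i))"
  have "t \<in> range (\<lambda>i. d $ i / u $ i)"
    unfolding t_def by (rule Max_in) auto
  then obtain i where i: "t = d $ i / u $ i"
    by auto
  have "d $ j / u $ j \<le> t" for j
    unfolding t_def by (rule Max_ge) auto
  then have d_le: "d $ j \<le> t * u $ j" for j
    by (simp only: pos_divide_le_eq[OF u])
  have di: "d $ i = t * u $ i"
    using i u[of i] by simp
  have "C $ i $ j * (t * u $ j) \<le> C $ i $ j * d $ j" for j
    using Z d_le[of j] di by (cases "j = i") (auto simp: Z_matrix_def intro: mult_left_mono_neg)
  then have "(\<Sum>j\<in>UNIV. C $ i $ j * (t * u $ j)) \<le> (C *v d) $ i"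
    unfolding matrix_vector_mult_def by (auto intro!: sum_mono)
  moreover have "(\<Sum>j\<in>UNIV. C $ i $ j * (t * u $ j)) = t * (C *v u) $ i"
    by (simp add: matrix_vector_mult_def sum_distrib_left mult_ac)
  moreover have "(C *v d) $ i \<le> 0"
    using le by (simp add: d_def matrix_vector_mult_diff_distrib less_eq_vec_def)
  ultimately have "t * (C *v u) $ i \<le> 0"
    by linarith
  then have "t \<le> 0"
    using Cu[of i] by (simp add: mult_le_0_iff)
  have "d $ j \<le> 0" for j
    using d_le[of j] mult_nonpos_nonneg[of t "u $ j"] \<open>t \<le> 0\<close> u[of j] by linarith
  then show ?thesis
    by (simp add: d_def less_eq_vec_def)
qed

text \<open>
  Here \<open>C\<inverse> T\<close> is the nonnegative iteration matrix of a regular splitting of \<open>C - T\<close>; the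
  positive vector \<open>u\<close> of \<open>C - T\<close> shows that it shrinks every box \<open>\<bar>x\<bar> \<le> c u\<close> by a fixed factor.
\<close>

lemma Z_matrix_recursion_tendsto_zero:
  fixes C T :: "real ^ 'n ^ 'n" and e :: "nat \<Rightarrow> real ^ 'n"
  assumes Z: "Z_matrix C" and T: "0 \<le> T" and M: "M_matrix (C - T)"
    and step: "\<And>k. C *v \<bar>e (Suc k)\<bar> \<le> T *v \<bar>e k\<bar>"
  shows "e \<longlonglongrightarrow> 0"
proof -
  obtain u where u: "\<And>i. 0 < u $ i" and "(C - T) *v u = 1"
    using M_matrix_positive_vector[OF M] by blast
  then have Cu: "C *v u = T *v u + 1"
    by (simp add: matrix_vector_mult_diff_rdistrib algebra_simps)
  have "0 \<le> T *v u"
    using matrix_vector_mult_mono_nonneg[OF T, of 0 u] u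
    by (simp add: less_eq_vec_def less_imp_le)
  then have Tu: "0 \<le> (T *v u) $ i" for i
    by (simp add: less_eq_vec_def)
  have Cu_pos: "0 < (C *v u) $ i" for i
    using Tu[of i] by (simp add: Cu)
  \<comment> \<open>The entries of \<open>T u\<close> are at most \<open>K\<close>, and \<open>s \<le> K\<close> is equivalent to \<open>s \<le> K / (1 + K) * (s + 1)\<close>.\<close>
  define K where "K = norm (T *v u)"
  define \<rho> where "\<rho> = K / (1 + K)"
  have K0: "0 \<le> K"
    by (simp add: K_def)
  have \<rho>: "0 \<le> \<rho>" "\<rho> < 1"
    using K0 by (auto simp: \<rho>_def)
  have "(T *v u) $ i \<le> \<rho> * (C *v u) $ i" for i
  proof -
    have "(T *v u) $ i \<le> K"
      using component_le_norm_cart[of "T *v u" i] by (simp add: K_def)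
    then show ?thesis
      using K0 by (simp add: \<rho>_def Cu field_simps)
  qed
  then have T_le_C: "T *v u \<le> \<rho> *\<^sub>R (C *v u)"
    by (simp add: less_eq_vec_def)
  have contract: "\<bar>e (Suc k)\<bar> \<le> (\<rho> * c) *\<^sub>R u" if "\<bar>e k\<bar> \<le> c *\<^sub>R u" "0 \<le> c" for k c
  proof (rule Z_matrix_reflects_le[OF Z u Cu_pos])
    have "C *v \<bar>e (Suc k)\<bar> \<le> T *v (c *\<^sub>R u)"
      using step[of k] matrix_vector_mult_mono_nonneg[OF T that(1)] by (rule order_trans)
    also have "\<dots> = c *\<^sub>R (T *v u)"
      by (simp add: matrix_vector_mult_scaleR)
    also have "\<dots> \<le> c *\<^sub>R (\<rho> *\<^sub>R (C *v u))"
      using T_le_C \<open>0 \<le> c\<close> by (simp add: less_eq_vec_def mult_left_mono mult.assoc)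
    also have "\<dots> = C *v ((\<rho> * c) *\<^sub>R u)"
      by (simp add: matrix_vector_mult_scaleR mult.commute)
    finally show "C *v \<bar>e (Suc k)\<bar> \<le> C *v ((\<rho> * c) *\<^sub>R u)" .
  qed
  define c where "c = (\<Sum>i\<in>UNIV. \<bar>e 0 $ i\<bar> / u $ i)"
  have c0: "0 \<le> c"
    using u by (auto simp: c_def intro!: sum_nonneg divide_nonneg_pos)
  have "\<bar>e 0 $ i\<bar> / u $ i \<le> c" for i
    unfolding c_def using u by (intro member_le_sum) (auto intro!: divide_nonneg_pos)
  then have start: "\<bar>e 0\<bar> \<le> c *\<^sub>R u"
    using u by (simp add: less_eq_vec_def abs_vec_def pos_divide_le_eq)
  have geometric: "\<bar>e k\<bar> \<le> (\<rho> ^ k * c) *\<^sub>R u" for k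
  proof (induction k)
    case 0
    show ?case using start by simp
  next
    case (Suc k)
    show ?case
      using contract[OF Suc] \<rho>(1) c0 by (simp add: mult.assoc)
  qed
  show ?thesis
  proof (rule vec_tendstoI)
    fix i
    have "(\<lambda>k. \<rho> ^ k * (c * u $ i)) \<longlonglongrightarrow> 0"
      using LIMSEQ_realpow_zero[OF \<rho>] by (rule tendsto_mult_left_zero)
    moreover have "norm (e k $ i) \<le> \<rho> ^ k * (c * u $ i)" for k
      using geometric[of k] by (simp add: less_eq_vec_def abs_vec_def mult.assoc)
    then have "\<forall>\<^sub>F k in sequentially. norm (e k $ i) \<le> \<rho> ^ k * (c * u $ i)"
      by (rule always_eventually[OF allI])
    ultimately have "(\<lambda>k. e k $ i) \<longlonglongrightarrow> 0"
      by (rule Lim_null_comparison[rotated])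
    then show "(\<lambda>k. e k $ i) \<longlonglongrightarrow> 0 $ i"
      by simp
  qed
qed

section \<open>Comparison matrices and compatible splittings\<close>

lemma Z_matrix_comparison: "Z_matrix (comparison_matrix A)"
  by (simp add: Z_matrix_def comparison_matrix_def)

text \<open>
  This is the reverse triangle inequality, applied in each row with the diagonal term as the
  distinguished one.
\<close>

lemma comparison_matrix_vector_le:
  fixes P :: "real ^ 'n ^ 'n"
  shows "comparison_matrix P *v \<bar>x\<bar> \<le> \<bar>P *v x\<bar>"
proof -
  have "(comparison_matrix P *v \<bar>x\<bar>) $ i \<le> \<bar>P *v x\<bar> $ i" for i
  proof -
    let ?R = "\<Sum>j\<in>UNIV - {i}. P $ i $ j * x $ j"
    have "(\<Sum>j\<in>UNIV - {i}. comparison_matrix P $ i $ j * \<bar>x\<bar> $ j)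
        = (\<Sum>j\<in>UNIV - {i}. - \<bar>P $ i $ j * x $ j\<bar>)"
      by (rule sum.cong) (auto simp: comparison_matrix_def abs_vec_def abs_mult)
    moreover have "comparison_matrix P $ i $ i * \<bar>x\<bar> $ i = \<bar>P $ i $ i * x $ i\<bar>"
      by (simp add: comparison_matrix_def abs_vec_def abs_mult)
    moreover have "(comparison_matrix P *v \<bar>x\<bar>) $ i = comparison_matrix P $ i $ i * \<bar>x\<bar> $ i
        + (\<Sum>j\<in>UNIV - {i}. comparison_matrix P $ i $ j * \<bar>x\<bar> $ j)"
      by (simp add: matrix_vector_mult_def sum.remove[of UNIV i "\<lambda>j. comparison_matrix P $ i $ j * \<bar>x\<bar> $ j"])
    ultimately have "(comparison_matrix P *v \<bar>x\<bar>) $ i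
        = \<bar>P $ i $ i * x $ i\<bar> - (\<Sum>j\<in>UNIV - {i}. \<bar>P $ i $ j * x $ j\<bar>)"
      by (simp add: sum_negf)
    also have "\<dots> \<le> \<bar>P $ i $ i * x $ i\<bar> - \<bar>?R\<bar>"
      by (simp add: sum_abs)
    also have "\<dots> \<le> \<bar>P $ i $ i * x $ i + ?R\<bar>"
      by linarith
    also have "\<dots> = \<bar>P *v x\<bar> $ i"
      by (simp add: matrix_vector_mult_def abs_vec_def sum.remove[of UNIV i "\<lambda>j. P $ i $ j * x $ j"])
    finally show ?thesis .
  qed
  then show ?thesis
    by (simp add: less_eq_vec_def)
qed

text \<open>
  On the diagonal, compatibility reads \<open>\<bar>m\<bar> = \<bar>a\<bar> + \<bar>m - a\<bar>\<close>: the number \<open>a\<close> lies between \<open>0\<close> and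
  \<open>m\<close>, so \<open>m\<close> cannot be negative when \<open>a\<close> is positive.
\<close>

lemma H_compatible_splitting_diag_nonneg:
  assumes "H_compatible_splitting A M N" "0 < A $ i $ i"
  shows "0 \<le> M $ i $ i"
proof -
  have split: "A = M - N" and comparison: "comparison_matrix A = comparison_matrix M - \<bar>N\<bar>"
    using assms(1) unfolding H_compatible_splitting_def by blast+
  have "A $ i $ i = M $ i $ i - N $ i $ i"
    by (simp add: split)
  moreover have "\<bar>A $ i $ i\<bar> = \<bar>M $ i $ i\<bar> - \<bar>N $ i $ i\<bar>"
    using arg_cong[OF comparison, of "\<lambda>X. X $ i $ i"]
    by (simp add: comparison_matrix_def abs_matrix_entry)
  ultimately show ?thesis
    using assms(2) by linarith
qed

lemma comparison_matrix_add_mat_1: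
  assumes "\<And>i. 0 \<le> Q $ i $ i"
  shows "comparison_matrix (Q + mat 1) = comparison_matrix Q + mat 1"
  using assms by (simp add: vec_eq_iff comparison_matrix_def mat_def)

lemma M_matrix_scaleR:
  fixes W :: "real ^ 'n ^ 'n"
  assumes "M_matrix W" "0 < c"
  shows "M_matrix (c *\<^sub>R W)"
proof -
  have inv: "invertible W"
    using assms by (simp add: M_matrix_def)
  have "matrix_inv (c *\<^sub>R W) = (1 / c) *\<^sub>R matrix_inv W"
    using \<open>0 < c\<close> matrix_inv_mult[OF inv]
    by (intro matrix_inv_eqI) (simp_all add: matrix_scalar_ac)
  then show ?thesis
    using assms scalar_invertible[of c W]
    by (auto simp: M_matrix_def Z_matrix_def less_eq_vec_def mult_nonneg_nonpos)
qed

text \<open>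
  Under condition (1) the two matrices coincide: both have \<open>2\<close> on the diagonal and
  \<open>-2 \<bar>a\<^sub>i\<^sub>j\<bar>\<close> off it. Under condition (2) the diagonal entry is \<open>a\<^sub>i\<^sub>i + 1 - (1 - a\<^sub>i\<^sub>i) = 2 a\<^sub>i\<^sub>i\<close>.
\<close>

lemma M_matrix_comparison_minus_modulus:
  fixes A :: "real ^ ('n :: {finite,linorder}) ^ ('n :: {finite,linorder})"
  assumes H: "H_plus_matrix A"
    and cond: "(mat 1 \<le> diag_part A \<and>
            M_matrix (comparison_matrix A + 2 *\<^sub>R mat 1 - diag_part A
              - \<bar>lower_part A + upper_part A\<bar>))
         \<or> (\<forall>i. A $ i $ i < 1)"
  shows "M_matrix (comparison_matrix A + mat 1 - \<bar>A - mat 1\<bar>)"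
  using cond
proof
  assume *: "mat 1 \<le> diag_part A \<and> M_matrix (comparison_matrix A + 2 *\<^sub>R mat 1 - diag_part A
      - \<bar>lower_part A + upper_part A\<bar>)"
  then have ge: "1 \<le> A $ i $ i" for i
    unfolding le_matrix_entrywise by (auto simp: mat_def diag_part_def dest!: spec[of _ i])
  have "comparison_matrix A + mat 1 - \<bar>A - mat 1\<bar>
      = comparison_matrix A + 2 *\<^sub>R mat 1 - diag_part A - \<bar>lower_part A + upper_part A\<bar>"
    using ge by (auto simp: vec_eq_iff abs_matrix_entry comparison_matrix_def mat_def
        diag_part_def lower_part_def upper_part_def)
  then show ?thesis
    using * by (simp only:)
next
  assume less: "\<forall>i. A $ i $ i < 1"
  have pos: "\<forall>i. 0 < A $ i $ i" and M: "M_matrix (comparison_matrix A)"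
    using H by (auto simp: H_plus_matrix_def H_matrix_def)
  have "comparison_matrix A + mat 1 - \<bar>A - mat 1\<bar> = 2 *\<^sub>R comparison_matrix A"
    using less pos by (auto simp: vec_eq_iff abs_matrix_entry comparison_matrix_def mat_def
        abs_of_pos abs_of_neg)
  then show ?thesis
    using M_matrix_scaleR[OF M, of 2] by simp
qed

section \<open>Convergence of the iteration\<close>

lemma iteration_map_error_bound:
  fixes A M N :: "real ^ 'n ^ 'n"
  defines "P \<equiv> M + 2 *\<^sub>R mat 1 + diag_part A"
  assumes inv: "invertible P"
  shows "comparison_matrix P *v \<bar>iteration_map A M N \<sigma> x - iteration_map A M N \<sigma> y\<bar>
    \<le> (\<bar>N + mat 1 + diag_part A\<bar> + \<bar>A - mat 1\<bar>) *v \<bar>x - y\<bar>"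
proof -
  let ?G = "iteration_map A M N \<sigma>"
  let ?Q = "N + mat 1 + diag_part A"
  let ?r = "\<lambda>z. (A - mat 1) *v z + \<sigma>"
  have P: "P *v ?G z = ?Q *v z + \<bar>?r z\<bar> - \<sigma>" for z
    using matrix_inv_mult[OF inv] by (simp add: iteration_map_def P_def matrix_vector_mul_assoc)
  have "comparison_matrix P *v \<bar>?G x - ?G y\<bar> \<le> \<bar>P *v (?G x - ?G y)\<bar>"
    by (rule comparison_matrix_vector_le)
  also have "P *v (?G x - ?G y) = ?Q *v (x - y) + (\<bar>?r x\<bar> - \<bar>?r y\<bar>)"
    by (simp add: matrix_vector_mult_diff_distrib P)
  also have "\<bar>\<dots>\<bar> \<le> \<bar>?Q *v (x - y)\<bar> + \<bar>?r x - ?r y\<bar>"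
    unfolding less_eq_vec_def by (auto simp: abs_vec_def)
  also have "?r x - ?r y = (A - mat 1) *v (x - y)"
    by (simp add: matrix_vector_mult_diff_distrib)
  also have "\<bar>?Q *v (x - y)\<bar> + \<bar>(A - mat 1) *v (x - y)\<bar>
      \<le> \<bar>?Q\<bar> *v \<bar>x - y\<bar> + \<bar>A - mat 1\<bar> *v \<bar>x - y\<bar>"
    by (intro add_mono abs_matrix_vector_mult_le)
  finally show ?thesis
    by (simp add: matrix_vector_mult_add_rdistrib)
qed

theorem theorem4p2:
  fixes A M N B :: "real ^ ('n :: {finite,linorder}) ^ ('n :: {finite,linorder})"
    and \<sigma> \<zeta>_star \<zeta>0 :: "real ^ ('n :: {finite,linorder})"
    and \<zeta> :: "nat \<Rightarrow> real ^ ('n :: {finite,linorder})"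
  assumes "H_plus_matrix A"
    and "H_compatible_splitting A M N"
    and "H_compatible_splitting A (M + mat 1 + diag_part A) (N + mat 1 + diag_part A)"
    and "invertible (M + 2 *\<^sub>R mat 1 + diag_part A)"
    and "B = lower_part A + upper_part A"
    and "(mat 1 \<le> diag_part A \<and>
            M_matrix (comparison_matrix A + 2 *\<^sub>R mat 1 - diag_part A - \<bar>B\<bar>))
         \<or> (\<forall>i. A $ i $ i < 1)"
    and "\<zeta>_star = iteration_map A M N \<sigma> \<zeta>_star"
    and "\<zeta> 0 = (\<chi> i. max 0 (\<zeta>0 $ i))"
    and "\<And>\<eta>. \<zeta> (Suc \<eta>) = iteration_map A M N \<sigma> (\<zeta> \<eta>)"
  shows "\<zeta> \<longlonglongrightarrow> \<zeta>_star"
proof -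
  let ?P = "M + 2 *\<^sub>R mat 1 + diag_part A"
  let ?Q = "M + mat 1 + diag_part A"
  let ?T = "\<bar>N + mat 1 + diag_part A\<bar> + \<bar>A - mat 1\<bar>"
  have pos: "0 < A $ i $ i" for i
    using assms(1) by (simp add: H_plus_matrix_def)
  have "0 \<le> ?Q $ i $ i" for i
    using H_compatible_splitting_diag_nonneg[OF assms(3) pos] .
  then have "comparison_matrix (?Q + mat 1) = comparison_matrix ?Q + mat 1"
    by (rule comparison_matrix_add_mat_1)
  moreover have "?P = ?Q + mat 1"
    by (simp add: scaleR_2)
  moreover have "comparison_matrix A = comparison_matrix ?Q - \<bar>N + mat 1 + diag_part A\<bar>"
    using assms(3) by (simp only: H_compatible_splitting_def)
  ultimately have split: "comparison_matrix ?P - ?T = comparison_matrix A + mat 1 - \<bar>A - mat 1\<bar>"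
    by (simp add: algebra_simps)
  have M: "M_matrix (comparison_matrix ?P - ?T)"
    unfolding split
    using M_matrix_comparison_minus_modulus[OF assms(1)] assms(6) unfolding assms(5) .
  have T: "0 \<le> ?T"
    unfolding le_matrix_entrywise by (simp add: abs_matrix_entry)
  have "comparison_matrix ?P *v \<bar>\<zeta> (Suc k) - \<zeta>_star\<bar> \<le> ?T *v \<bar>\<zeta> k - \<zeta>_star\<bar>" for k
    using iteration_map_error_bound[OF assms(4), of N \<sigma> "\<zeta> k" \<zeta>_star]
    unfolding assms(9)[symmetric] assms(7)[symmetric] .
  then have "(\<lambda>k. \<zeta> k - \<zeta>_star) \<longlonglongrightarrow> 0"
    by (rule Z_matrix_recursion_tendsto_zero[OF Z_matrix_comparison T M])
  then show ?thesis
    by (rule LIM_zero_cancel)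
qed

end
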